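(* Extension Roman Hitting Set is solvable in polynomial time.
   Context: A hypergraph is $H=(X,(s_i)_{i\in I})$ with finite $X$, finite index set $I$, $s_i\subseteq X$ (repetitions allowed). A pair $(R_1,R_2)$ with $R_1\subseteq I$, $R_2\subseteq X$ is a Roman hitting set (rhs) if for every $i\in I$, $s_i\cap R_2\ne\emptyset$ or $i\in R_1$. Pairs are ordered componentwise by inclusion: $(P_1,P_2)\le(R_1,R_2)$ iff $P_1\subseteq R_1$ and $P_2\subseteq R_2$; an rhs $P$ is minimal if every rhs $R\le P$ equals $P$. Extension Roman Hitting Set: given $H$ and a pair $U=(U_1,U_2)$ with $U_1\subseteq I$, $U_2\subseteq X$, decide whether there is a minimal rhs $R$ of $H$ with $U\le R$. *)

theory Defs
  imports Main "HOL-Library.Product_Order" "HOL-Computational_Algebra.Polynomial"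
begin

section \<open>Hypergraphs and Roman hitting sets\<close>

record ('x, 'i) hypergraph =
  vertices :: "'x set"
  indices :: "'i set"
  edge :: "'i \<Rightarrow> 'x set"

definition is_hypergraph :: "('x, 'i) hypergraph \<Rightarrow> bool" where
  "is_hypergraph H \<longleftrightarrow>
     finite (vertices H) \<and> finite (indices H) \<and> (\<forall>i\<in>indices H. edge H i \<subseteq> vertices H)"

definition is_pair :: "('x, 'i) hypergraph \<Rightarrow> 'i set \<times> 'x set \<Rightarrow> bool" where
  "is_pair H R \<longleftrightarrow> fst R \<subseteq> indices H \<and> snd R \<subseteq> vertices H"

definition rhs :: "('x, 'i) hypergraph \<Rightarrow> 'i set \<times> 'x set \<Rightarrow> bool" where
  "rhs H R \<longleftrightarrow> is_pair H R \<and> (\<forall>i\<in>indices H. edge H i \<inter> snd R \<noteq> {} \<or> i \<in> fst R)"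

text \<open>The order \<open>\<le>\<close> on pairs is the componentwise one of \<^theory>\<open>HOL-Library.Product_Order\<close>,
  which on pairs of sets is componentwise inclusion.\<close>

definition minimal_rhs :: "('x, 'i) hypergraph \<Rightarrow> 'i set \<times> 'x set \<Rightarrow> bool" where
  "minimal_rhs H P \<longleftrightarrow> rhs H P \<and> (\<forall>R. rhs H R \<and> R \<le> P \<longrightarrow> R = P)"

definition ext_rhs :: "('x, 'i) hypergraph \<Rightarrow> 'i set \<times> 'x set \<Rightarrow> bool" where
  "ext_rhs H U \<longleftrightarrow> (\<exists>R. minimal_rhs H R \<and> U \<le> R)"

section \<open>Instances as binary strings\<close>

text \<open>Relative to enumerations \<open>xs\<close> of the vertices and \<open>js\<close> of the indices, an instance
  \<open>(H, (U\<^sub>1, U\<^sub>2))\<close> is written as the number of vertices in unary, the characteristic vector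
  of \<open>U\<^sub>2\<close>, and then, for each index \<open>i\<close>, one bit for \<open>i \<in> U\<^sub>1\<close> followed by the row of the
  incidence matrix belonging to \<open>i\<close>.\<close>

definition encode ::
  "'x list \<Rightarrow> 'i list \<Rightarrow> ('x, 'i) hypergraph \<Rightarrow> 'i set \<times> 'x set \<Rightarrow> bool list" where
  "encode xs js H U =
     replicate (length xs) True @ [False] @
     map (\<lambda>x. x \<in> snd U) xs @
     concat (map (\<lambda>i. (i \<in> fst U) # map (\<lambda>x. x \<in> edge H i) xs) js)"

definition is_enumeration :: "'a list \<Rightarrow> 'a set \<Rightarrow> bool" where
  "is_enumeration xs A \<longleftrightarrow> distinct xs \<and> set xs = A"

text \<open>Vertices and indices are natural numbers so that one language covers all finite
  hypergraphs up to renaming.\<close>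

definition ext_rhs_language :: "bool list set" where
  "ext_rhs_language =
     {encode xs js H U | xs js (H :: (nat, nat) hypergraph) U.
        is_hypergraph H \<and> is_pair H U \<and>
        is_enumeration xs (vertices H) \<and> is_enumeration js (indices H) \<and>
        ext_rhs H U}"

text \<open>The encoding determines the instance up to renaming vertices and indices, so no string
  encodes both a yes-instance and a no-instance.\<close>

lemma replicate_True_False_inject:
  assumes "replicate m True @ False # u = replicate n True @ False # v"
  shows "m = n \<and> u = v"
  using assms
proof (induction m arbitrary: n)
  case 0
  then show ?case by (cases n) auto
next
  case (Suc m)
  then show ?case by (cases n) auto
qed

lemma concat_map_inject:
  assumes "concat (map f as) = concat (map g bs)"
    and "\<And>a. length (f a) = Suc k" and "\<And>b. length (g b) = Suc k"
  shows "map f as = map g bs"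
  using assms(1)
proof (induction as arbitrary: bs)
  case Nil
  show ?case
  proof (cases bs)
    case (Cons b cs)
    then have "g b = []" using Nil by simp
    then show ?thesis using assms(3)[of b] by simp
  qed simp
next
  case (Cons a as)
  show ?case
  proof (cases bs)
    case Nil
    then have "f a = []" using Cons.prems by simp
    then show ?thesis using assms(2)[of a] by simp
  next
    case (Cons b cs)
    then show ?thesis using Cons.prems Cons.IH[of cs] assms(2)[of a] assms(3)[of b] by simp
  qed
qed

lemma encode_inject:
  assumes "encode xs js H U = encode xs' js' H' U'"
  shows "length xs = length xs'" and "length js = length js'"
    and "\<And>k. k < length xs \<Longrightarrow> xs ! k \<in> snd U \<longleftrightarrow> xs' ! k \<in> snd U'"
    and "\<And>l. l < length js \<Longrightarrow> js ! l \<in> fst U \<longleftrightarrow> js' ! l \<in> fst U'"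
    and "\<And>k l. k < length xs \<Longrightarrow> l < length js \<Longrightarrow>
           xs ! k \<in> edge H (js ! l) \<longleftrightarrow> xs' ! k \<in> edge H' (js' ! l)"
proof -
  let ?f = "\<lambda>i. (i \<in> fst U) # map (\<lambda>x. x \<in> edge H i) xs"
  let ?g = "\<lambda>i. (i \<in> fst U') # map (\<lambda>x. x \<in> edge H' i) xs'"
  have len: "length xs = length xs'"
    and rest: "map (\<lambda>x. x \<in> snd U) xs @ concat (map ?f js)
             = map (\<lambda>x. x \<in> snd U') xs' @ concat (map ?g js')"
    using replicate_True_False_inject assms unfolding encode_def append_Cons append_Nil by blast+
  show "length xs = length xs'" by (fact len)
  have vec: "map (\<lambda>x. x \<in> snd U) xs = map (\<lambda>x. x \<in> snd U') xs'"
    and "concat (map ?f js) = concat (map ?g js')"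
    using rest len by simp_all
  then have rows: "map ?f js = map ?g js'"
    using len by (intro concat_map_inject[where k = "length xs"]) simp_all
  show ljs: "length js = length js'" using arg_cong[OF rows, of length] by simp
  show "xs ! k \<in> snd U \<longleftrightarrow> xs' ! k \<in> snd U'" if "k < length xs" for k
    using arg_cong[OF vec, of "\<lambda>v. v ! k"] that len by simp
  have row: "?f (js ! l) = ?g (js' ! l)" if "l < length js" for l
    using arg_cong[OF rows, of "\<lambda>v. v ! l"] that ljs by simp
  show "js ! l \<in> fst U \<longleftrightarrow> js' ! l \<in> fst U'" if "l < length js" for l
    using row[OF that] by simp
  show "xs ! k \<in> edge H (js ! l) \<longleftrightarrow> xs' ! k \<in> edge H' (js' ! l)"
    if "k < length xs" "l < length js" for k l
  proof -
    have "map (\<lambda>x. x \<in> edge H (js ! l)) xs = map (\<lambda>x. x \<in> edge H' (js' ! l)) xs'"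
      using row[OF that(2)] by simp
    from arg_cong[OF this, of "\<lambda>v. v ! k"] show ?thesis using that(1) len by simp
  qed
qed

section \<open>Polynomial time on deterministic multi-tape Turing machines\<close>

datatype direction = Go_Left | Stay | Go_Right

text \<open>States and tape symbols are initial segments of the natural numbers: state 0 is the
  start state, 1 and 2 are the accepting and the rejecting halting states; symbol 0 is the
  blank, 1 and 2 represent the input bits. The transition function maps a state and the symbols
  under the heads to a state and, for each tape, a symbol to write and a head movement.\<close>

record tm =
  num_tapes :: nat
  num_states :: nat
  num_symbols :: nat
  delta :: "nat \<Rightarrow> nat list \<Rightarrow> nat \<times> (nat \<times> direction) list"

definition accept_state :: nat where "accept_state = 1"

definition reject_state :: nat where "reject_state = 2"

definition is_tm :: "tm \<Rightarrow> bool" where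
  "is_tm M \<longleftrightarrow>
     num_tapes M \<ge> 1 \<and> num_states M \<ge> 3 \<and> num_symbols M \<ge> 3 \<and>
     (\<forall>q ss. q < num_states M \<and> length ss = num_tapes M \<and> (\<forall>s\<in>set ss. s < num_symbols M) \<longrightarrow>
        (case delta M q ss of (q', acts) \<Rightarrow>
           q' < num_states M \<and> length acts = num_tapes M \<and>
           (\<forall>(s, d)\<in>set acts. s < num_symbols M)))"

text \<open>A tape, infinite in both directions, is given by its head position and its contents.\<close>

type_synonym tape = "int \<times> (int \<Rightarrow> nat)"

type_synonym config = "nat \<times> tape list"

fun read_tape :: "tape \<Rightarrow> nat" where
  "read_tape (h, c) = c h"

fun move :: "direction \<Rightarrow> int \<Rightarrow> int" where
  "move Go_Left h = h - 1"
| "move Stay h = h"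
| "move Go_Right h = h + 1"

fun act_tape :: "nat \<times> direction \<Rightarrow> tape \<Rightarrow> tape" where
  "act_tape (s, d) (h, c) = (move d h, c(h := s))"

fun step :: "tm \<Rightarrow> config \<Rightarrow> config" where
  "step M (q, ts) =
     (if q = accept_state \<or> q = reject_state then (q, ts)
      else case delta M q (map read_tape ts) of (q', acts) \<Rightarrow> (q', map2 act_tape acts ts))"

definition input_tape :: "bool list \<Rightarrow> tape" where
  "input_tape w =
     (0, \<lambda>p. if 0 \<le> p \<and> p < int (length w) then (if w ! nat p then 2 else 1) else 0)"

definition blank_tape :: tape where
  "blank_tape = (0, \<lambda>_. 0)"

definition initial_config :: "tm \<Rightarrow> bool list \<Rightarrow> config" where
  "initial_config M w = (0, input_tape w # replicate (num_tapes M - 1) blank_tape)"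

definition decides_in_time :: "tm \<Rightarrow> bool list set \<Rightarrow> (nat \<Rightarrow> nat) \<Rightarrow> bool" where
  "decides_in_time M L T \<longleftrightarrow>
     (\<forall>w. \<exists>t \<le> T (length w).
        fst ((step M ^^ t) (initial_config M w)) =
          (if w \<in> L then accept_state else reject_state))"

definition PTIME :: "bool list set set" where
  "PTIME = {L. \<exists>M (p :: nat poly). is_tm M \<and> decides_in_time M L (poly p)}"

end

theory Submission
  imports Defs "HOL-Library.Countable"
begin

text \<open>Shrinking \<open>R\<^sub>2\<close> to \<open>U\<^sub>2\<close> keeps private edges private and only enlarges the set of unhit
  edges, so \<open>U\<close> extends to a minimal rhs iff no edge indexed by \<open>U\<^sub>1\<close> meets \<open>U\<^sub>2\<close> and every
  vertex of \<open>U\<^sub>2\<close> is the only vertex of \<open>U\<^sub>2\<close> in some edge. A two-tape machine tests this in linear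
  time: it keeps \<open>U\<^sub>2\<close> on the second tape between two end markers and compares it with each row
  of the input, marking the vertices of \<open>U\<^sub>2\<close> in the row tentatively and counting them up to two.
  On the way back to the left end the tentative marks become permanent if there was exactly one,
  and are erased otherwise. Finally all of \<open>U\<^sub>2\<close> must be marked.\<close>

section \<open>Extendable pairs\<close>

definition unhit :: "('x, 'i) hypergraph \<Rightarrow> 'x set \<Rightarrow> 'i set" where
  "unhit H X = {i \<in> indices H. edge H i \<inter> X = {}}"

definition has_private_edges :: "('x, 'i) hypergraph \<Rightarrow> 'x set \<Rightarrow> bool" where
  "has_private_edges H X \<longleftrightarrow> (\<forall>x\<in>X. \<exists>i\<in>indices H. edge H i \<inter> X = {x})"

lemma unhit_antimono: "X \<subseteq> Y \<Longrightarrow> unhit H Y \<subseteq> unhit H X"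
  by (auto simp: unhit_def)

lemma has_private_edges_subset: "has_private_edges H Y \<Longrightarrow> X \<subseteq> Y \<Longrightarrow> has_private_edges H X"
  unfolding has_private_edges_def by fast

lemma rhs_iff_unhit_subset: "rhs H R \<longleftrightarrow> is_pair H R \<and> unhit H (snd R) \<subseteq> fst R"
  by (auto simp: rhs_def unhit_def)

lemma minimal_rhs_fst_eq_unhit:
  assumes "minimal_rhs H R"
  shows "fst R = unhit H (snd R)"
proof -
  have "rhs H (unhit H (snd R), snd R)" "(unhit H (snd R), snd R) \<le> R"
    using assms
    by (auto simp: minimal_rhs_def rhs_iff_unhit_subset is_pair_def less_eq_prod_def unhit_def)
  then have "(unhit H (snd R), snd R) = R"
    using assms unfolding minimal_rhs_def by blast
  then show ?thesis by (metis fst_conv)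
qed

lemma minimal_rhs_has_private_edges:
  assumes "minimal_rhs H R"
  shows "has_private_edges H (snd R)"
  unfolding has_private_edges_def
proof
  fix x assume "x \<in> snd R"
  then have "(fst R, snd R - {x}) \<le> R" "(fst R, snd R - {x}) \<noteq> R"
    by (auto simp: less_eq_prod_def prod_eq_iff)
  moreover have "is_pair H (fst R, snd R - {x})"
    using assms by (auto simp: minimal_rhs_def rhs_def is_pair_def)
  ultimately have "\<not> unhit H (snd R - {x}) \<subseteq> fst R"
    using assms by (auto simp: minimal_rhs_def rhs_iff_unhit_subset)
  then obtain i where "i \<in> indices H" "edge H i \<inter> (snd R - {x}) = {}" "edge H i \<inter> snd R \<noteq> {}"
    unfolding minimal_rhs_fst_eq_unhit[OF assms] by (auto simp: unhit_def)
  then show "\<exists>i\<in>indices H. edge H i \<inter> snd R = {x}" by (intro bexI[of _ i]) auto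
qed

lemma minimal_rhs_unhitI:
  assumes "X \<subseteq> vertices H" and "has_private_edges H X"
  shows "minimal_rhs H (unhit H X, X)"
proof -
  have "S = (unhit H X, X)" if "rhs H S" and "S \<le> (unhit H X, X)" for S
  proof -
    have subset: "unhit H (snd S) \<subseteq> fst S" "fst S \<subseteq> unhit H X" "snd S \<subseteq> X"
      using that by (auto simp: rhs_iff_unhit_subset less_eq_prod_def)
    have "x \<in> snd S" if "x \<in> X" for x
    proof -
      obtain i where i: "i \<in> indices H" "edge H i \<inter> X = {x}"
        using assms(2) \<open>x \<in> X\<close> by (auto simp: has_private_edges_def)
      then have "i \<notin> unhit H X" by (simp add: unhit_def)
      then have "edge H i \<inter> snd S \<noteq> {}" using subset i(1) by (auto simp: unhit_def)
      moreover have "edge H i \<inter> snd S \<subseteq> {x}" using subset(3) i(2) by blast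
      ultimately show ?thesis by blast
    qed
    then have "snd S = X" using subset(3) by blast
    then show ?thesis using subset(1,2) by (simp add: prod_eq_iff)
  qed
  moreover have "rhs H (unhit H X, X)"
    using assms(1) by (auto simp: rhs_iff_unhit_subset is_pair_def unhit_def)
  ultimately show ?thesis unfolding minimal_rhs_def by blast
qed

lemma ext_rhs_iff:
  assumes "is_pair H U"
  shows "ext_rhs H U \<longleftrightarrow> fst U \<subseteq> unhit H (snd U) \<and> has_private_edges H (snd U)"
proof
  assume "ext_rhs H U"
  then obtain R where minimal: "minimal_rhs H R" and "fst U \<subseteq> fst R" and "snd U \<subseteq> snd R"
    by (auto simp: ext_rhs_def less_eq_prod_def)
  then show "fst U \<subseteq> unhit H (snd U) \<and> has_private_edges H (snd U)"
    using minimal_rhs_fst_eq_unhit[OF minimal] unhit_antimono[of "snd U" "snd R" H]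
      has_private_edges_subset[OF minimal_rhs_has_private_edges[OF minimal]] by auto
next
  assume "fst U \<subseteq> unhit H (snd U) \<and> has_private_edges H (snd U)"
  then have "minimal_rhs H (unhit H (snd U), snd U)" "U \<le> (unhit H (snd U), snd U)"
    using assms by (auto simp: is_pair_def less_eq_prod_def intro: minimal_rhs_unhitI)
  then show "ext_rhs H U" unfolding ext_rhs_def by blast
qed

section \<open>Words and instances\<close>

definition encodes_instance ::
  "'x list \<Rightarrow> 'i list \<Rightarrow> ('x, 'i) hypergraph \<Rightarrow> 'i set \<times> 'x set \<Rightarrow> bool" where
  "encodes_instance xs js H U \<longleftrightarrow> is_hypergraph H \<and> is_pair H U \<and>
     is_enumeration xs (vertices H) \<and> is_enumeration js (indices H)"

lemma ext_rhs_iff_nth: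
  assumes "encodes_instance xs js H U"
  shows "ext_rhs H U \<longleftrightarrow>
    (\<forall>l<length js. js ! l \<in> fst U \<longrightarrow>
      (\<forall>k<length xs. \<not> (xs ! k \<in> edge H (js ! l) \<and> xs ! k \<in> snd U))) \<and>
    (\<forall>k<length xs. xs ! k \<in> snd U \<longrightarrow> (\<exists>l<length js. \<forall>k'<length xs.
      xs ! k' \<in> edge H (js ! l) \<and> xs ! k' \<in> snd U \<longleftrightarrow> k' = k))"
proof -
  have distinct: "distinct xs" and pair: "is_pair H U" and js: "set js = indices H"
    and U: "fst U \<subseteq> set js" "snd U \<subseteq> set xs"
    using assms by (auto simp: encodes_instance_def is_enumeration_def is_pair_def)
  have private_iff: "edge H i \<inter> snd U = {xs ! k} \<longleftrightarrow>
      (\<forall>k'<length xs. xs ! k' \<in> edge H i \<and> xs ! k' \<in> snd U \<longleftrightarrow> k' = k)"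
    if "k < length xs" for i k
  proof -
    have "edge H i \<inter> snd U = {xs ! k} \<longleftrightarrow> (\<forall>x\<in>set xs. x \<in> edge H i \<and> x \<in> snd U \<longleftrightarrow> x = xs ! k)"
      using U(2) that by auto
    then show ?thesis using that distinct by (simp add: all_set_conv_all_nth nth_eq_iff_index_eq)
  qed
  have "fst U \<subseteq> unhit H (snd U) \<longleftrightarrow>
      (\<forall>i\<in>set js. i \<in> fst U \<longrightarrow> (\<forall>x\<in>set xs. \<not> (x \<in> edge H i \<and> x \<in> snd U)))"
    using U js unfolding unhit_def by blast
  moreover have "has_private_edges H (snd U) \<longleftrightarrow>
      (\<forall>x\<in>set xs. x \<in> snd U \<longrightarrow> (\<exists>i\<in>set js. edge H i \<inter> snd U = {x}))"
    unfolding has_private_edges_def js using U(2) by blast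
  moreover have "(\<exists>i\<in>set js. P i) \<longleftrightarrow> (\<exists>l<length js. P (js ! l))" for P
    by (metis in_set_conv_nth)
  ultimately show ?thesis
    by (simp add: ext_rhs_iff[OF pair] private_iff all_set_conv_all_nth cong: imp_cong)
qed

lemma ext_rhs_cong_encode:
  assumes "encodes_instance xs js H U" and "encodes_instance xs' js' H' U'"
    and "encode xs js H U = encode xs' js' H' U'"
  shows "ext_rhs H U \<longleftrightarrow> ext_rhs H' U'"
  unfolding ext_rhs_iff_nth[OF assms(1)] ext_rhs_iff_nth[OF assms(2)]
  using encode_inject[OF assms(3)] by (simp cong: conj_cong imp_cong)

lemma length_encode: "length (encode xs js H U) = 2 * length xs + 1 + length js * Suc (length xs)"
  by (simp add: encode_def length_concat comp_def sum_list_triv)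

lemma encode_append_in_ext_rhs_language_iff:
  fixes H :: "(nat, nat) hypergraph"
  assumes inst: "encodes_instance xs js H U" and rest: "length rest \<le> length xs"
  shows "encode xs js H U @ rest \<in> ext_rhs_language \<longleftrightarrow> rest = [] \<and> ext_rhs H U"
proof
  assume "encode xs js H U @ rest \<in> ext_rhs_language"
  then obtain xs' js' and H' :: "(nat, nat) hypergraph" and U'
    where eq: "encode xs js H U @ rest = encode xs' js' H' U'"
      and inst': "encodes_instance xs' js' H' U'" and ext: "ext_rhs H' U'"
    unfolding ext_rhs_language_def encodes_instance_def by blast
  have "length xs = length xs'"
    using eq by (auto simp: encode_def dest!: replicate_True_False_inject)
  then have "length js * Suc (length xs) + length rest = length js' * Suc (length xs)"
    using arg_cong[OF eq, of length] by (simp add: length_encode)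
  then have "length rest mod Suc (length xs) = 0"
    by (metis mod_mult_self3 mod_mult_self2_is_0)
  then have "rest = []" using rest by simp
  then show "rest = [] \<and> ext_rhs H U" using ext_rhs_cong_encode[OF inst inst'] eq ext by simp
next
  assume "rest = [] \<and> ext_rhs H U"
  then show "encode xs js H U @ rest \<in> ext_rhs_language"
    using inst unfolding ext_rhs_language_def encodes_instance_def append_Nil2 by blast
qed

lemma replicate_True_notin_ext_rhs_language: "replicate n True \<notin> ext_rhs_language"
proof -
  have "False \<in> set w" if "w \<in> ext_rhs_language" for w
    using that by (auto simp: ext_rhs_language_def encode_def)
  from this[of "replicate n True"] show ?thesis by auto
qed

lemma short_word_notin_ext_rhs_language:
  assumes "length ws < n"
  shows "replicate n True @ False # ws \<notin> ext_rhs_language"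
proof
  assume "replicate n True @ False # ws \<in> ext_rhs_language"
  then obtain xs js and H :: "(nat, nat) hypergraph" and U
    where "replicate n True @ False # ws = encode xs js H U"
    unfolding ext_rhs_language_def by blast
  then have "n = length xs" and "length xs \<le> length ws"
    by (auto simp: encode_def dest!: replicate_True_False_inject)
  then show False using assms by simp
qed

lemma concat_take_drop_blocks:
  "concat (map (\<lambda>i. take k (drop (i * k) xs)) [0..<m]) = take (m * k) xs"
  by (induction m) (simp_all add: take_add add.commute[of k])

lemma encode_exists:
  assumes "\<And>r. r \<in> set rows \<Longrightarrow> length r = Suc (length u)"
  shows "\<exists>(H :: (nat, nat) hypergraph) U.
    encodes_instance [0..<length u] [0..<length rows] H U \<and>
    encode [0..<length u] [0..<length rows] H U =
      replicate (length u) True @ False # u @ concat rows"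
proof -
  define H :: "(nat, nat) hypergraph" where
    "H = \<lparr>vertices = {..<length u}, indices = {..<length rows},
          edge = (\<lambda>i. {k. k < length u \<and> rows ! i ! Suc k})\<rparr>"
  define U where "U = ({i. i < length rows \<and> rows ! i ! 0}, {k. k < length u \<and> u ! k})"
  have "(i \<in> fst U) # map (\<lambda>x. x \<in> edge H i) [0..<length u] = rows ! i" if "i < length rows" for i
  proof (rule nth_equalityI)
    show "length ((i \<in> fst U) # map (\<lambda>x. x \<in> edge H i) [0..<length u]) = length (rows ! i)"
      using assms that by simp
    fix k assume "k < length ((i \<in> fst U) # map (\<lambda>x. x \<in> edge H i) [0..<length u])"
    then show "((i \<in> fst U) # map (\<lambda>x. x \<in> edge H i) [0..<length u]) ! k = rows ! i ! k"
      using that by (cases k) (auto simp: U_def H_def)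
  qed
  then have "map (\<lambda>i. (i \<in> fst U) # map (\<lambda>x. x \<in> edge H i) [0..<length u])
      [0..<length rows] = rows"
    by (intro nth_equalityI) simp_all
  moreover have "map (\<lambda>x. x \<in> snd U) [0..<length u] = u"
    by (intro nth_equalityI) (auto simp: U_def)
  moreover have "encodes_instance [0..<length u] [0..<length rows] H U"
    by (auto simp: encodes_instance_def is_hypergraph_def is_pair_def is_enumeration_def
        H_def U_def)
  ultimately show ?thesis by (intro exI[of _ H] exI[of _ U]) (simp add: encode_def)
qed

lemma encode_prefix_exists:
  assumes "n \<le> length ws"
  shows "\<exists>xs js (H :: (nat, nat) hypergraph) U rest. encodes_instance xs js H U \<and>
    length rest \<le> length xs \<and> replicate n True @ False # ws = encode xs js H U @ rest"
proof -
  define body where "body = drop n ws"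
  define m where "m = length body div Suc n"
  define rows where "rows = map (\<lambda>i. take (Suc n) (drop (i * Suc n) body)) [0..<m]"
  have "length r = Suc (length (take n ws))" if "r \<in> set rows" for r
  proof -
    obtain i where "i < m" "r = take (Suc n) (drop (i * Suc n) body)"
      using \<open>r \<in> set rows\<close> by (auto simp: rows_def)
    moreover have "Suc i * Suc n \<le> length body"
      using \<open>i < m\<close> mult_le_mono1[of "Suc i" m "Suc n"]
        div_times_less_eq_dividend[of "length body" "Suc n"]
      unfolding m_def by linarith
    ultimately show ?thesis using assms by simp
  qed
  then obtain xs js and H :: "(nat, nat) hypergraph" and U
    where inst: "encodes_instance xs js H U" and len: "length xs = n"
    and eq: "encode xs js H U = replicate n True @ False # take n ws @ concat rows"
    using encode_exists[of rows "take n ws"] assms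
    by (metis diff_zero length_take length_upt min.absorb2)
  have "concat rows = take (m * Suc n) body"
    unfolding rows_def by (rule concat_take_drop_blocks)
  moreover have "take n ws @ body = ws" by (simp add: body_def)
  ultimately have "replicate n True @ False # ws = encode xs js H U @ drop (m * Suc n) body"
    by (simp add: eq)
  moreover have "length (drop (m * Suc n) body) \<le> length xs"
    unfolding m_def length_drop minus_div_mult_eq_mod len by (rule mod_Suc_le_divisor)
  ultimately show ?thesis using inst by blast
qed

lemma word_cases:
  obtains (unary) n where "w = replicate n True"
  | (short) n ws where "w = replicate n True @ False # ws" "length ws < n"
  | (encode) xs js and H :: "(nat, nat) hypergraph" and U rest
      where "w = encode xs js H U @ rest" "encodes_instance xs js H U" "length rest \<le> length xs"
proof (cases "False \<in> set w")
  case True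
  then obtain us ws where split: "w = us @ False # ws" "False \<notin> set us"
    by (metis split_list_first)
  then have "us = replicate (length us) True" by (metis replicate_length_same)
  then show thesis
    using split short encode encode_prefix_exists by (metis not_le)
next
  case False
  then show thesis using unary by (metis replicate_length_same)
qed

section \<open>Machines with a one-way input tape and one work tape\<close>

datatype ('q, 'c) action =
  Halt bool
| Continue (next_state: 'q) (advance: bool) (written: 'c) (direction: direction)

subsection \<open>Tapes as zippers\<close>

text \<open>In \<open>(ls, rs)\<close> the first cell of \<open>rs\<close> is under the head and \<open>ls\<close> lists the cells to its left,
  nearest first; all other cells are blank.\<close>

type_synonym 'c zipper = "'c list \<times> 'c list"

abbreviation head :: "'c \<Rightarrow> 'c list \<Rightarrow> 'c" where
  "head b xs \<equiv> nth_default b xs 0"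

fun cell_at :: "'c \<Rightarrow> 'c zipper \<Rightarrow> int \<Rightarrow> 'c" where
  "cell_at b (ls, rs) z =
     (if 0 \<le> z then nth_default b rs (nat z) else nth_default b ls (nat (- z - 1)))"

fun shift :: "'c \<Rightarrow> direction \<Rightarrow> 'c zipper \<Rightarrow> 'c zipper" where
  "shift b Go_Left (ls, rs) = (tl ls, head b ls # rs)"
| "shift b Stay (ls, rs) = (ls, rs)"
| "shift b Go_Right (ls, rs) = (head b rs # ls, tl rs)"

lemma nth_default_tl: "nth_default b (tl xs) n = nth_default b xs (Suc n)"
  by (cases xs) simp_all

lemma cell_at_shift: "cell_at b (shift b d T) z = cell_at b T (move d z)"
  by (cases T; cases d)
    (auto simp: nth_default_tl nth_default_Cons split: nat.split
      intro!: arg_cong[of _ _ "nth_default b _"])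

lemma cell_at_write: "cell_at b (ls, c # tl rs) z = (if z = 0 then c else cell_at b (ls, rs) z)"
  by (cases "nat z") (auto simp: nth_default_tl)

definition represents :: "('c \<Rightarrow> nat) \<Rightarrow> 'c \<Rightarrow> tape \<Rightarrow> 'c zipper \<Rightarrow> bool" where
  "represents code b t T \<longleftrightarrow> (\<forall>z. snd t (fst t + z) = code (cell_at b T z))"

lemma represents_read_tape:
  "represents code b t (ls, rs) \<Longrightarrow> read_tape t = code (head b rs)"
  by (cases t) (auto simp: represents_def dest!: spec[of _ 0])

lemma represents_act_tape:
  assumes "represents code b t (ls, rs)"
  shows "represents code b (act_tape (code c, d) t) (shift b d (ls, c # tl rs))"
proof (cases t)
  case (Pair h contents)
  have "move d h + z = h + move d z" for z by (cases d) simp_all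
  then show ?thesis using assms Pair
    by (auto simp: represents_def cell_at_shift cell_at_write simp del: cell_at.simps)
qed

subsection \<open>Simulation by Turing machines\<close>

fun input_code :: "bool option \<Rightarrow> nat" where
  "input_code None = 0"
| "input_code (Some False) = 1"
| "input_code (Some True) = 2"

lemma inj_input_code: "inj input_code"
proof (rule injI)
  show "input_code x = input_code y \<Longrightarrow> x = y" for x y
    by (cases x rule: input_code.cases; cases y rule: input_code.cases) simp_all
qed

lemma represents_input_tape: "represents input_code None (input_tape w) ([], map Some w)"
  by (auto simp: represents_def input_tape_def nth_default_def)

locale one_way_machine =
  fixes \<delta> :: "'q::finite \<Rightarrow> bool option \<Rightarrow> 'c::finite \<Rightarrow> ('q, 'c) action"
    and start :: 'q
    and blank :: 'c
begin

text \<open>A configuration consists of the state, the unread input and the work tape.\<close>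

fun halts :: "nat \<Rightarrow> 'q \<times> bool list \<times> 'c zipper \<Rightarrow> bool \<Rightarrow> bool" where
  "halts 0 _ _ \<longleftrightarrow> False"
| "halts (Suc n) (q, ws, ls, rs) result \<longleftrightarrow>
     (case \<delta> q (head None (map Some ws)) (head blank rs) of
        Halt verdict \<Rightarrow> verdict = result
      | Continue q' adv c d \<Rightarrow>
          halts n (q', if adv then tl ws else ws, shift blank d (ls, c # tl rs)) result)"

lemma halts_mono: "halts m A result \<Longrightarrow> m \<le> n \<Longrightarrow> halts n A result"
proof (induction m A result arbitrary: n rule: halts.induct)
  case (2 m q ws ls rs result)
  then obtain n' where "n = Suc n'" by (cases n) auto
  then show ?case using 2 by (auto split: action.splits)
qed simp

definition state_code :: "'q \<Rightarrow> nat" where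
  "state_code q = (if q = start then 0 else to_nat q + 3)"

definition cell_code :: "'c \<Rightarrow> nat" where
  "cell_code c = (if c = blank then 0 else Suc (to_nat c))"

definition machine :: tm where
  "machine = \<lparr>num_tapes = 2,
     num_states = max 3 (Suc (Max (range state_code))),
     num_symbols = max 3 (Suc (Max (range cell_code))),
     delta = (\<lambda>q ss.
       case \<delta> (inv state_code q) (inv input_code (ss ! 0)) (inv cell_code (ss ! 1)) of
         Halt verdict \<Rightarrow>
           (if verdict then accept_state else reject_state, [(ss ! 0, Stay), (ss ! 1, Stay)])
       | Continue q' adv c d \<Rightarrow>
           (state_code q', [(ss ! 0, if adv then Go_Right else Stay), (cell_code c, d)]))\<rparr>"

lemma inj_state_code: "inj state_code"
  by (auto simp: inj_def state_code_def split: if_splits)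

lemma inj_cell_code: "inj cell_code"
  by (auto simp: inj_def cell_code_def split: if_splits)

lemma state_code_not_halting: "state_code q \<noteq> accept_state" "state_code q \<noteq> reject_state"
  by (auto simp: state_code_def accept_state_def reject_state_def)

lemma state_code_less: "state_code q < num_states machine"
  by (simp add: machine_def less_Suc_eq_le le_max_iff_disj)

lemma cell_code_less: "cell_code c < num_symbols machine"
  by (simp add: machine_def less_Suc_eq_le le_max_iff_disj)

lemma is_tm_machine: "is_tm machine"
proof -
  have "case delta machine q ss of (q', acts) \<Rightarrow> q' < num_states machine \<and>
      length acts = num_tapes machine \<and> (\<forall>(s, d)\<in>set acts. s < num_symbols machine)"
    if "length ss = num_tapes machine" "\<forall>s\<in>set ss. s < num_symbols machine" for q ss
  proof -
    have "ss ! 0 < num_symbols machine" "ss ! 1 < num_symbols machine"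
      using that by (simp_all add: machine_def)
    then show ?thesis
      using state_code_less cell_code_less
      by (auto simp: machine_def accept_state_def reject_state_def split: action.split)
  qed
  then show ?thesis by (auto simp: is_tm_def machine_def)
qed

fun simulates :: "config \<Rightarrow> 'q \<times> bool list \<times> 'c zipper \<Rightarrow> bool" where
  "simulates C (q, ws, T) \<longleftrightarrow> (\<exists>t t' us. C = (state_code q, [t, t']) \<and>
     represents input_code None t (us, map Some ws) \<and> represents cell_code blank t' T)"

lemma simulates_initial: "simulates (initial_config machine w) (start, w, [], [])"
proof -
  have "represents cell_code blank blank_tape ([], [])"
    by (simp add: represents_def blank_tape_def cell_code_def)
  moreover have "initial_config machine w = (state_code start, [input_tape w, blank_tape])"
    by (simp add: initial_config_def machine_def state_code_def)
  ultimately show ?thesis using represents_input_tape by auto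
qed

lemma step_machine:
  assumes "represents input_code None t (us, map Some ws)"
    and "represents cell_code blank t' (ls, rs)"
  shows "step machine (state_code q, [t, t']) =
    (case \<delta> q (head None (map Some ws)) (head blank rs) of
       Halt verdict \<Rightarrow> (if verdict then accept_state else reject_state,
         [act_tape (read_tape t, Stay) t, act_tape (read_tape t', Stay) t'])
     | Continue q' adv c d \<Rightarrow> (state_code q',
         [act_tape (read_tape t, if adv then Go_Right else Stay) t,
          act_tape (cell_code c, d) t']))"
  using represents_read_tape[OF assms(1)] represents_read_tape[OF assms(2)]
  by (simp add: machine_def state_code_not_halting inj_state_code inj_input_code inj_cell_code
      split: action.split)

lemma step_machine_Halt:
  assumes "simulates C (q, ws, ls, rs)"
    and "\<delta> q (head None (map Some ws)) (head blank rs) = Halt verdict"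
  shows "fst (step machine C) = (if verdict then accept_state else reject_state)"
proof -
  obtain t t' us where "C = (state_code q, [t, t'])"
    and "represents input_code None t (us, map Some ws)"
    and "represents cell_code blank t' (ls, rs)"
    using assms(1) by auto
  then show ?thesis by (simp add: step_machine assms(2) del: step.simps)
qed

lemma simulates_step_Continue:
  assumes "simulates C (q, ws, ls, rs)"
    and "\<delta> q (head None (map Some ws)) (head blank rs) = Continue q' adv c d"
  shows "simulates (step machine C)
    (q', if adv then tl ws else ws, shift blank d (ls, c # tl rs))"
proof -
  obtain t t' us where config: "C = (state_code q, [t, t'])"
    and input: "represents input_code None t (us, map Some ws)"
    and work: "represents cell_code blank t' (ls, rs)"
    using assms(1) by auto
  let ?in = "head None (map Some ws)"
  have "represents input_code None (act_tape (read_tape t, Go_Right) t)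
      (?in # us, map Some (tl ws))"
    using represents_act_tape[OF input, of ?in Go_Right] represents_read_tape[OF input]
    by (simp add: map_tl)
  moreover have "act_tape (read_tape t, Stay) t = t" by (cases t) simp
  ultimately have "\<exists>us'. represents input_code None
      (act_tape (read_tape t, if adv then Go_Right else Stay) t)
      (us', map Some (if adv then tl ws else ws))"
    using input by auto
  then show ?thesis
    using represents_act_tape[OF work, of c d]
    by (simp add: config step_machine[OF input work] assms(2) del: step.simps)
qed

lemma halts_imp_machine_halts:
  assumes "halts n A result" and "simulates C A"
  shows "\<exists>t\<le>n. fst ((step machine ^^ t) C) = (if result then accept_state else reject_state)"
  using assms
proof (induction n arbitrary: A C)
  case 0
  then show ?case by simp
next
  case (Suc n)
  obtain q ws ls rs where config: "A = (q, ws, ls, rs)" by (cases A)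
  show ?case
  proof (cases "\<delta> q (head None (map Some ws)) (head blank rs)")
    case (Halt verdict)
    then have "verdict = result" using Suc.prems(1) by (simp add: config)
    then show ?thesis
      using step_machine_Halt[OF _ Halt] Suc.prems(2) by (intro exI[of _ 1]) (simp add: config)
  next
    case (Continue q' adv c d)
    let ?A' = "(q', if adv then tl ws else ws, shift blank d (ls, c # tl rs))"
    have "halts n ?A' result" using Suc.prems(1) by (simp add: config Continue)
    moreover have "simulates (step machine C) ?A'"
      using Suc.prems(2) simulates_step_Continue[OF _ Continue] unfolding config by blast
    ultimately obtain t where "t \<le> n"
      "fst ((step machine ^^ t) (step machine C)) =
        (if result then accept_state else reject_state)"
      using Suc.IH by blast
    then show ?thesis
      by (intro exI[of _ "Suc t"]) (simp add: funpow_swap1)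
  qed
qed

theorem in_PTIME:
  assumes "\<And>w. halts (poly p (length w)) (start, w, [], []) (w \<in> L)"
  shows "L \<in> PTIME"
proof -
  have "decides_in_time machine L (poly p)"
    unfolding decides_in_time_def
    using halts_imp_machine_halts[OF assms simulates_initial] by blast
  then show ?thesis unfolding PTIME_def using is_tm_machine by blast
qed

end

section \<open>A linear-time machine for extendable pairs\<close>

datatype cell = Blank | End | Vertex (selected: bool) (marked: bool) (tentative: bool)

datatype count = Zero | One | Many

datatype state = Start | Unary | Load | Next_Row | Scan bool count | Return bool

instance cell :: finite
proof
  have "c \<in> {Blank, End} \<union> range (\<lambda>(x, m, t). Vertex x m t)" for c
    by (cases c) (auto simp: image_iff)
  then have "UNIV \<subseteq> {Blank, End} \<union> range (\<lambda>(x, m, t). Vertex x m t)" by blast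
  then show "finite (UNIV :: cell set)" by (rule finite_subset) simp
qed

instance count :: finite
proof
  have "c \<in> {Zero, One, Many}" for c by (cases c) simp_all
  then have "UNIV \<subseteq> {Zero, One, Many}" by blast
  then show "finite (UNIV :: count set)" by (rule finite_subset) simp
qed

instance state :: finite
proof
  have "q \<in> {Start, Unary, Load, Next_Row} \<union> range (\<lambda>(f, c). Scan f c) \<union> range Return" for q
    by (cases q) (auto simp: image_iff)
  then have "UNIV \<subseteq> {Start, Unary, Load, Next_Row} \<union> range (\<lambda>(f, c). Scan f c) \<union> range Return"
    by blast
  then show "finite (UNIV :: state set)" by (rule finite_subset) simp
qed

fun increment :: "count \<Rightarrow> count" where
  "increment Zero = One"
| "increment _ = Many"

abbreviation unselected :: cell where
  "unselected \<equiv> Vertex False False False"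

text \<open>The unary prefix is copied to the work tape from right to left, so that afterwards the head
  is at the left end. The flag of \<open>Scan\<close> tells whether the index of the row is in \<open>U\<^sub>1\<close>, and that of
  \<open>Return\<close> whether the tentative marks become permanent.\<close>

fun transition :: "state \<Rightarrow> bool option \<Rightarrow> cell \<Rightarrow> (state, cell) action" where
  "transition Start _ _ = Continue Unary False End Go_Left"
| "transition Unary (Some True) _ = Continue Unary True unselected Go_Left"
| "transition Unary (Some False) _ = Continue Load True End Go_Right"
| "transition Load (Some x) (Vertex _ _ _) = Continue Load True (Vertex x False False) Go_Right"
| "transition Load _ End = Continue (Return False) False End Go_Left"
| "transition (Return k) _ (Vertex x m t) =
     Continue (Return k) False (Vertex x (m \<or> k \<and> t) False) Go_Left"
| "transition (Return _) _ End = Continue Next_Row False End Go_Right"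
| "transition Next_Row (Some f) v = Continue (Scan f Zero) True v Stay"
| "transition Next_Row None (Vertex x m t) =
     (if x \<and> \<not> m then Halt False else Continue Next_Row False (Vertex x m t) Go_Right)"
| "transition Next_Row None End = Halt True"
| "transition (Scan f n) (Some r) (Vertex x m _) =
     Continue (Scan f (if r \<and> x then increment n else n)) True (Vertex x m (r \<and> x)) Go_Right"
| "transition (Scan f n) _ End =
     (if f \<and> n \<noteq> Zero then Halt False else Continue (Return (n = One)) False End Go_Left)"
| "transition _ _ _ = Halt False"

interpretation recognizer: one_way_machine transition Start Blank .

lemmas halts_Suc = recognizer.halts.simps(2)
declare halts_Suc [simp del]

definition vertex_cell :: "'x set \<Rightarrow> 'x set \<Rightarrow> 'x set \<Rightarrow> 'x \<Rightarrow> cell" where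
  "vertex_cell X M T x = Vertex (x \<in> X) (x \<in> M) (x \<in> T)"

abbreviation track :: "'x set \<Rightarrow> 'x set \<Rightarrow> 'x set \<Rightarrow> 'x list \<Rightarrow> cell list" where
  "track X M T xs \<equiv> map (vertex_cell X M T) xs"

abbreviation row_start ::
  "bool list \<Rightarrow> 'x set \<Rightarrow> 'x set \<Rightarrow> 'x list \<Rightarrow> state \<times> bool list \<times> cell zipper" where
  "row_start ws X M xs \<equiv> (Next_Row, ws, [End], track X M {} xs @ [End])"

lemma halts_unary:
  assumes "recognizer.halts n (Unary, ws, [], Blank # replicate k unselected @ rs) result"
  shows "recognizer.halts (n + k) (Unary, replicate k True @ ws, [], Blank # rs) result"
  using assms
proof (induction k arbitrary: rs)
  case (Suc k)
  then show ?case by (simp add: halts_Suc replicate_app_Cons_same)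
qed simp

lemma halts_load:
  assumes "recognizer.halts n (Load, ws, rev (track X {} {} xs) @ ls, rs) result"
  shows "recognizer.halts (n + length xs) (Load, map (\<lambda>x. x \<in> X) xs @ ws, ls,
    replicate (length xs) unselected @ rs) result"
  using assms by (induction xs arbitrary: ls) (simp_all add: halts_Suc vertex_cell_def)

lemma halts_scan:
  assumes "recognizer.halts n (Scan f ((increment ^^ length (filter (\<lambda>x. x \<in> E \<inter> X) xs)) c), ws,
    rev (track X M (E \<inter> X) xs) @ ls, rs) result"
  shows "recognizer.halts (n + length xs) (Scan f c, map (\<lambda>x. x \<in> E) xs @ ws, ls,
    track X M T xs @ rs) result"
  using assms
  by (induction xs arbitrary: c ls)
    (auto simp: halts_Suc vertex_cell_def funpow_swap1 split: if_splits)

lemma halts_input_exhausted: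
  assumes "list_all is_Vertex vs" and "length ws < length vs"
    and "q = Load \<or> (\<exists>f c. q = Scan f c)"
  shows "recognizer.halts (Suc (length ws)) (q, ws, ls, vs @ rs) False"
  using assms
proof (induction ws arbitrary: q ls vs)
  case Nil
  then show ?case by (cases vs) (auto simp: halts_Suc is_Vertex_def)
next
  case (Cons r ws)
  then obtain x m t vs' where "vs = Vertex x m t # vs'" by (cases vs) (auto simp: is_Vertex_def)
  then show ?case using Cons by (auto simp: halts_Suc)
qed

lemma halts_return:
  assumes "recognizer.halts n (Next_Row, ws, End # ls,
    track X (if k then M \<union> T else M) {} xs @ rs) result"
  shows "recognizer.halts (n + length xs + 1)
    (Return k, ws, shift Blank Go_Left (rev (track X M T xs) @ End # ls, rs)) result"
  using assms
  by (cases k; induction xs arbitrary: rs rule: rev_induct) (auto simp: halts_Suc vertex_cell_def)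

lemma halts_after_last_row:
  "recognizer.halts (Suc (length xs)) (Next_Row, [], ls, track X M T xs @ End # rs)
     (\<forall>x\<in>set xs. x \<in> X \<longrightarrow> x \<in> M)"
  by (induction xs arbitrary: ls) (auto simp: halts_Suc vertex_cell_def)

lemma funpow_increment_Zero:
  "(increment ^^ n) Zero = (if n = 0 then Zero else if n = 1 then One else Many)"
  by (induction n) auto

definition add_mark :: "'x set \<Rightarrow> 'x set \<Rightarrow> 'x set \<Rightarrow> 'x set" where
  "add_mark X E M = (if card (E \<inter> X) = 1 then M \<union> E \<inter> X else M)"

lemma mem_add_mark_iff:
  assumes "x \<in> X"
  shows "x \<in> add_mark X E M \<longleftrightarrow> x \<in> M \<or> E \<inter> X = {x}"
proof -
  have "card (E \<inter> X) = 1 \<and> x \<in> E \<longleftrightarrow> E \<inter> X = {x}"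
    using assms by (metis IntD1 IntI One_nat_def card_1_singleton_iff singletonD singletonI)
  then show ?thesis using assms by (auto simp: add_mark_def)
qed

lemma halts_row:
  assumes xs: "distinct xs" "X \<subseteq> set xs"
    and forbidden: "f \<and> E \<inter> X \<noteq> {} \<Longrightarrow> \<not> result"
    and allowed: "\<not> (f \<and> E \<inter> X \<noteq> {}) \<Longrightarrow> recognizer.halts n
      (row_start ws X (add_mark X E M) xs) result"
  shows "recognizer.halts (n + 2 * length xs + 3)
    (row_start (f # map (\<lambda>x. x \<in> E) xs @ ws) X M xs) result"
proof -
  have "finite (E \<inter> X)" using xs(2) finite_subset by fastforce
  define hits where "hits = (increment ^^ card (E \<inter> X)) Zero"
  have hits: "hits = Zero \<longleftrightarrow> E \<inter> X = {}" "hits = One \<longleftrightarrow> card (E \<inter> X) = 1"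
    using \<open>finite (E \<inter> X)\<close> by (auto simp: hits_def funpow_increment_Zero)
  have "recognizer.halts (n + length xs + 2)
    (Scan f hits, ws, rev (track X M (E \<inter> X) xs) @ [End], [End]) result"
  proof (cases "f \<and> E \<inter> X \<noteq> {}")
    case True
    then show ?thesis using forbidden by (simp add: halts_Suc hits(1))
  next
    case False
    have "recognizer.halts (n + length xs + 1) (Return (hits = One), ws,
      shift Blank Go_Left (rev (track X M (E \<inter> X) xs) @ [End], [End])) result"
      using allowed[OF False] by (intro halts_return) (simp add: add_mark_def hits(2))
    then show ?thesis using False by (auto simp: halts_Suc hits(1))
  qed
  moreover have "length (filter (\<lambda>x. x \<in> E \<inter> X) xs) = card (E \<inter> X)"
    using xs by (simp add: distinct_length_filter Int_absorb2 Int_assoc flip: Int_def)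
  ultimately have "recognizer.halts (n + length xs + 2 + length xs)
    (Scan f Zero, map (\<lambda>x. x \<in> E) xs @ ws, [End], track X M {} xs @ [End]) result"
    by (intro halts_scan) (simp only: hits_def)
  then have "recognizer.halts (Suc (n + length xs + 2 + length xs))
    (row_start (f # map (\<lambda>x. x \<in> E) xs @ ws) X M xs) result"
    by (cases xs) (simp_all add: halts_Suc)
  then show ?thesis by (rule recognizer.halts_mono) simp
qed

lemma halts_incomplete_row:
  assumes "length r < length xs"
  shows "recognizer.halts (length r + 2)
    (row_start (f # r) X M xs) False"
proof -
  have "recognizer.halts (Suc (length r))
    (Scan f Zero, r, [End], track X M {} xs @ [End]) False"
    using assms by (intro halts_input_exhausted) (auto simp: list_all_iff vertex_cell_def)
  then show ?thesis by (cases xs) (simp_all add: halts_Suc)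
qed

lemma halts_rows:
  assumes "distinct xs" and "X \<subseteq> set xs" and "length rest \<le> length xs"
  shows "recognizer.halts (length js * (2 * length xs + 3) + length xs + 1)
    (row_start (concat (map (\<lambda>i. f i # map (\<lambda>x. x \<in> E i) xs) js) @ rest) X M xs)
    (rest = [] \<and> (\<forall>i\<in>set js. f i \<longrightarrow> E i \<inter> X = {}) \<and>
      (\<forall>x\<in>X. x \<in> M \<or> (\<exists>i\<in>set js. E i \<inter> X = {x})))"
proof (induction js arbitrary: M)
  case Nil
  show ?case
  proof (cases rest)
    case Nil
    moreover have "(\<forall>x\<in>set xs. x \<in> X \<longrightarrow> x \<in> M) \<longleftrightarrow> (\<forall>x\<in>X. x \<in> M)"
      using assms(2) by blast
    ultimately show ?thesis
      using halts_after_last_row[of xs "[End]" X M "{}" "[]"] by simp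
  next
    case (Cons f r)
    then show ?thesis
      using assms(3) recognizer.halts_mono[OF halts_incomplete_row[of r xs f X M]] by simp
  qed
next
  case (Cons i js)
  have "(\<forall>x\<in>X. x \<in> add_mark X (E i) M \<or> (\<exists>i'\<in>set js. E i' \<inter> X = {x})) \<longleftrightarrow>
      (\<forall>x\<in>X. x \<in> M \<or> (\<exists>i'\<in>set (i # js). E i' \<inter> X = {x}))"
    by (auto simp: mem_add_mark_iff)
  then have "recognizer.halts (length js * (2 * length xs + 3) + length xs + 1 + 2 * length xs + 3)
    (row_start (f i # map (\<lambda>x. x \<in> E i) xs @
      concat (map (\<lambda>i. f i # map (\<lambda>x. x \<in> E i) xs) js) @ rest) X M xs)
    (rest = [] \<and> (\<forall>i\<in>set (i # js). f i \<longrightarrow> E i \<inter> X = {}) \<and>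
      (\<forall>x\<in>X. x \<in> M \<or> (\<exists>i'\<in>set (i # js). E i' \<inter> X = {x})))"
    using Cons.IH[of "add_mark X (E i) M"] assms(1,2) by (intro halts_row) auto
  then show ?case by (simp add: algebra_simps)
qed

lemma halts_unary_prefix:
  assumes "recognizer.halts n (Load, ws, [End], replicate k unselected @ [End]) result"
  shows "recognizer.halts (n + k + 2) (Start, replicate k True @ False # ws, [], []) result"
proof -
  have "recognizer.halts (Suc n) (Unary, False # ws, [],
    Blank # replicate k unselected @ [End]) result"
    using assms by (simp add: halts_Suc)
  from halts_unary[OF this] show ?thesis by (simp add: halts_Suc add.commute)
qed

lemma halts_encode:
  assumes "encodes_instance xs js H U" and "length rest \<le> length xs"
  shows "recognizer.halts (length js * (2 * length xs + 3) + 4 * length xs + 5)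
    (Start, encode xs js H U @ rest, [], []) (rest = [] \<and> ext_rhs H U)"
proof -
  have xs: "distinct xs" "snd U \<subseteq> set xs" and js: "set js = indices H"
    and pair: "is_pair H U"
    using assms(1) by (auto simp: encodes_instance_def is_enumeration_def is_pair_def)
  let ?X = "snd U"
  let ?rows = "concat (map (\<lambda>i. (i \<in> fst U) # map (\<lambda>x. x \<in> edge H i) xs) js) @ rest"
  let ?m = "length js * (2 * length xs + 3) + length xs + 1"
  have "ext_rhs H U \<longleftrightarrow> (\<forall>i\<in>set js. i \<in> fst U \<longrightarrow> edge H i \<inter> ?X = {}) \<and>
      (\<forall>x\<in>?X. \<exists>i\<in>set js. edge H i \<inter> ?X = {x})"
    using pair by (auto simp: ext_rhs_iff unhit_def has_private_edges_def is_pair_def js)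
  then have "recognizer.halts ?m (row_start ?rows ?X {} xs)
    (rest = [] \<and> ext_rhs H U)"
    using halts_rows[OF xs assms(2), of js "\<lambda>i. i \<in> fst U" "edge H" "{}"] by simp
  then have "recognizer.halts (?m + length xs + 1) (Return False, ?rows,
    shift Blank Go_Left (rev (track ?X {} {} xs) @ [End], [End])) (rest = [] \<and> ext_rhs H U)"
    by (intro halts_return) simp
  then have "recognizer.halts (Suc (?m + length xs + 1)) (Load, ?rows,
    rev (track ?X {} {} xs) @ [End], [End]) (rest = [] \<and> ext_rhs H U)"
    by (simp add: halts_Suc)
  from halts_unary_prefix[OF halts_load[OF this]] show ?thesis
    by (auto simp: encode_def elim: recognizer.halts_mono)
qed

lemma halts_replicate_True: "recognizer.halts (n + 2) (Start, replicate n True, [], []) False"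
proof -
  have "recognizer.halts 1 (Unary, [], [], Blank # replicate n unselected @ [End]) False"
    by (simp add: halts_Suc)
  from halts_unary[OF this] show ?thesis by (simp add: halts_Suc)
qed

lemma halts_short_word:
  assumes "length ws < n"
  shows "recognizer.halts (Suc (length ws) + n + 2)
    (Start, replicate n True @ False # ws, [], []) False"
  using assms by (intro halts_unary_prefix halts_input_exhausted) (simp_all add: list_all_iff)

theorem theorem6: "ext_rhs_language \<in> PTIME"
proof (rule recognizer.in_PTIME)
  fix w
  show "recognizer.halts (poly [:2, 3:] (length w)) (Start, w, [], []) (w \<in> ext_rhs_language)"
  proof (cases w rule: word_cases)
    case (unary n)
    then show ?thesis
      using recognizer.halts_mono[OF halts_replicate_True[of n]]
      by (simp add: replicate_True_notin_ext_rhs_language)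
  next
    case (short n ws)
    then show ?thesis
      using recognizer.halts_mono[OF halts_short_word]
      by (simp add: short_word_notin_ext_rhs_language)
  next
    case (encode xs js H U rest)
    show ?thesis
      unfolding encode(1) encode_append_in_ext_rhs_language_iff[OF encode(2,3)]
      by (rule recognizer.halts_mono[OF halts_encode[OF encode(2,3)]])
        (simp add: length_encode algebra_simps)
  qed
qed

end
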